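(* Let $G$ be a connected graph with $v(G)=k\ge 2$ vertices, and let $N_G$ be the number of copies of $G$ in the binomial random-connection model $G_H(\mathcal{X}_n)$ with connection probabilities $p_nH(X_i,X_j)$. Suppose that $$\mathrm{Var}\Big[\sum_{\ell=1}^k f_{(\ell)}(X_1)\Big]>0 .$$ Then $$\mathrm{Var}[N_G]\ge\frac{C}{a(G)^2}\left(\frac{n!}{(n-2k+1)!}p_n^{2e(G)}+\frac{n!}{(n-k)!}p_n^{e(G)}\right),$$ where $C>0$ is a constant independent of $n\ge 2k-1$.
   Context: Binomial random-connection model. $X_1,\dots,X_n$ are i.i.d. random points of $\mathbb{R}^d$ with common continuous (atomless) distribution $\mu$, $\mathcal{X}_n=\{X_1,\dots,X_n\}$, $H:\mathbb{R}^d\times\mathbb{R}^d\to[0,1]$ is a symmetric measurable function, and $p_n\in(0,1)$; $\mu$ and $H$ do not depend on $n$. Given $\mathcal{X}_n$, each pair $X_i,X_j$ ($i\ne j$) is connected by an edge (written $X_i\sim X_j$) independently with probability $p_nH(X_i,X_j)$. The resulting random graph is $G_H(\mathcal{X}_n)$. Subgraph count. $G=(V_G,E_G)$ is a simple graph with vertex set identified with $[k]=\{1,\dots,k\}$, $e(G)=|E_G|$, and $a(G)$ is the number of automorphisms of $G$. With $[n]^k_{\neq}:=\{\beta\in[n]^k:\beta(i)\ne\beta(j)\text{ for }i\ne j\}$, $$N_G:=\frac{1}{a(G)}\sum_{\beta\in[n]^k_{\neq}}\ \prod_{\{u,v\}\in E_G}\mathbf{1}_{\{X_{\beta(u)}\sim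 X_{\beta(v)}\}}.$$ For $1\le\ell\le k$, $$f_{(\ell)}(x):=\frac{p_n^{e(G)}}{a(G)}\int_{(\mathbb{R}^d)^{k-1}}\prod_{\{u,v\}\in E_G}H(x_u,x_v)\,\mu^{\otimes(k-1)}(\mathrm{d}x_1,\dots,\mathrm{d}x_{\ell-1},\mathrm{d}x_{\ell+1},\dots,\mathrm{d}x_k),\qquad x_\ell:=x.$$ Since $p_n\in(0,1)$, the variance condition does not depend on $n$. *)

theory Defs
  imports "HOL-Probability.Probability" "HOL-Combinatorics.Permutations"
begin

text \<open>Simple graphs on the vertex set \<open>{1..k}\<close>, given by their set of edges (two-element sets).\<close>

definition vertex_pairs :: "nat \<Rightarrow> nat set set" where
  "vertex_pairs n = {e. e \<subseteq> {1..n} \<and> card e = 2}"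

definition simple_graph :: "nat \<Rightarrow> nat set set \<Rightarrow> bool" where
  "simple_graph k E \<longleftrightarrow> E \<subseteq> vertex_pairs k"

definition connected_graph :: "nat \<Rightarrow> nat set set \<Rightarrow> bool" where
  "connected_graph k E \<longleftrightarrow>
     simple_graph k E \<and> (\<forall>u\<in>{1..k}. \<forall>v\<in>{1..k}. (u, v) \<in> {(x, y). {x, y} \<in> E}\<^sup>*)"

definition automorphisms :: "nat \<Rightarrow> nat set set \<Rightarrow> (nat \<Rightarrow> nat) set" where
  "automorphisms k E =
     {\<pi>. \<pi> permutes {1..k} \<and> (\<forall>u\<in>{1..k}. \<forall>v\<in>{1..k}. {\<pi> u, \<pi> v} \<in> E \<longleftrightarrow> {u, v} \<in> E)}"

abbreviation num_aut :: "nat \<Rightarrow> nat set set \<Rightarrow> nat" where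
  "num_aut k E \<equiv> card (automorphisms k E)"

text \<open>
  The value \<open>H (x u) (x v)\<close> on an unordered pair \<open>e = {u, v}\<close>. For symmetric \<open>H\<close>, the only
  case of interest, evaluating at \<open>(Min e, Max e)\<close> is just a choice of orientation.
\<close>

definition on_pair :: "('a \<Rightarrow> 'a \<Rightarrow> real) \<Rightarrow> (nat \<Rightarrow> 'a) \<Rightarrow> nat set \<Rightarrow> real" where
  "on_pair H x e = H (x (Min e)) (x (Max e))"

text \<open>
  The binomial random-connection model: \<open>A {i, j}\<close> is the event that \<open>X i\<close> and \<open>X j\<close> are joined
  by an edge. The last assumption says that, given \<open>X 1, \<dots>, X n\<close>, these events are independent
  and \<open>A {i, j}\<close> has conditional probability \<open>p * H (X i) (X j)\<close>; the conditioning is on the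
  sigma-algebra generated by \<open>X 1, \<dots>, X n\<close>.
\<close>

locale binomial_rcm = prob_space M
  for M :: "'w measure" +
  fixes n :: nat
    and \<mu> :: "'a::euclidean_space measure"
    and H :: "'a \<Rightarrow> 'a \<Rightarrow> real"
    and p :: real
    and X :: "nat \<Rightarrow> 'w \<Rightarrow> 'a"
    and A :: "nat set \<Rightarrow> 'w set"
  assumes indep_points: "indep_vars (\<lambda>_. borel) X {1..n}"
    and distr_points: "\<And>i. i \<in> {1..n} \<Longrightarrow> distr M borel (X i) = \<mu>"
    and edge_events: "\<And>e. e \<in> vertex_pairs n \<Longrightarrow> A e \<in> events"
    and cond_indep_edges: "\<And>S. S \<subseteq> vertex_pairs n \<Longrightarrow>
      AE \<omega> in M.
        real_cond_exp M
          (vimage_algebra (space M) (\<lambda>\<omega>. \<lambda>i\<in>{1..n}. X i \<omega>) (Pi\<^sub>M {1..n} (\<lambda>_. borel)))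
          (\<lambda>\<omega>. \<Prod>e\<in>S. indicator (A e) \<omega>) \<omega>
        = (\<Prod>e\<in>S. p * on_pair H (\<lambda>i. X i \<omega>) e)"

definition injections :: "nat \<Rightarrow> nat \<Rightarrow> (nat \<Rightarrow> nat) set" where
  "injections k n = {\<beta> \<in> {1..k} \<rightarrow>\<^sub>E {1..n}. inj_on \<beta> {1..k}}"

definition subgraph_count ::
    "nat \<Rightarrow> nat set set \<Rightarrow> nat \<Rightarrow> (nat set \<Rightarrow> 'w set) \<Rightarrow> 'w \<Rightarrow> real" where
  "subgraph_count k E n A \<omega> =
     1 / real (num_aut k E) * (\<Sum>\<beta>\<in>injections k n. \<Prod>e\<in>E. indicator (A (\<beta> ` e)) \<omega>)"

definition f_proj ::
    "nat \<Rightarrow> nat set set \<Rightarrow> 'a measure \<Rightarrow> ('a \<Rightarrow> 'a \<Rightarrow> real) \<Rightarrow> real \<Rightarrow> nat \<Rightarrow> 'a \<Rightarrow> real" where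
  "f_proj k E \<mu> H p l x =
     p ^ card E / real (num_aut k E) *
       (\<integral>y. (\<Prod>e\<in>E. on_pair H (y(l := x)) e) \<partial>(Pi\<^sub>M ({1..k} - {l}) (\<lambda>_. \<mu>)))"

end

theory Submission
  imports Defs
begin

text \<open>
  Write \<open>W\<^sub>\<beta>\<close> for the product of the values of \<open>H\<close> over the edges of the copy \<open>\<beta>\<close>, \<open>U\<close> for the sum of
  the \<open>W\<^sub>\<beta>\<close>, and \<open>h\<close> for the common mean of the \<open>W\<^sub>\<beta>\<close>. Two copies together have at most
  \<open>2 * card E\<close> distinct edges, so the mixed moment of their indicators is at least
  \<open>p ^ (2 * card E) * E[W\<^sub>\<beta> W\<^sub>\<gamma>]\<close>, with an excess of at least \<open>(p ^ card E - p ^ (2 * card E)) * h\<close> on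
  the diagonal. Summing, the variance of the number of labelled copies is at least
  \<open>p ^ (2 * card E) * Var[U] + (p ^ card E - p ^ (2 * card E)) * h * n! / (n - k)!\<close>.

  The variable \<open>U\<close> depends only on the independent points. Testing it against the sum \<open>T\<close> of the
  centred first-order projections \<open>\<phi> (X i)\<close>, which are uncorrelated with variance \<open>\<sigma>2 > 0\<close>, gives
  \<open>Var[U] \<ge> (n! / (n - k)!)\<^sup>2 / n * \<sigma>2\<close>, and this dominates \<open>n! / (n - 2 * k + 1)! * \<sigma>2\<close>. With
  \<open>a = n! / (n - 2 * k + 1)!\<close>, \<open>b = n! / (n - k)! \<le> a\<close> and \<open>q = p ^ card E\<close>, the total
  \<open>q\<^sup>2 * a * \<sigma>2 + (q - q\<^sup>2) * b * h\<close> is at least \<open>q\<^sup>2 * (a + b) * \<sigma>2 / 2 + (q - q\<^sup>2) * b * h\<close>, so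
  \<open>C = min (\<sigma>2 / 2) h\<close> works.
\<close>

section \<open>Vertex pairs, edges and injections\<close>

lemma vertex_pairsE:
  assumes "e \<in> vertex_pairs n"
  obtains u v where "e = {u, v}" "u < v" "u \<in> {1..n}" "v \<in> {1..n}"
proof -
  from assms have "e \<subseteq> {1..n}" "card e = 2" by (auto simp: vertex_pairs_def)
  then obtain u v where "e = {u, v}" "u \<noteq> v" by (auto simp: card_2_iff)
  with \<open>e \<subseteq> {1..n}\<close> show ?thesis
    using that[of u v] that[of v u] by (cases u v rule: linorder_cases) (auto simp: insert_commute)
qed

lemma on_pair_less [simp]: "u < v \<Longrightarrow> on_pair H x {u, v} = H (x u) (x v)"
  by (simp add: on_pair_def)

text \<open>An injection may reverse the order of the endpoints of an edge, swapping
  \<open>Min\<close> and \<open>Max\<close> of its image; symmetry of \<open>H\<close> absorbs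
  this.\<close>

lemma on_pair_doubleton:
  assumes "\<And>x y. H x y = H y x" "u \<noteq> v"
  shows "on_pair H x {u, v} = H (x u) (x v)"
  using assms by (auto simp: on_pair_def min_def max_def)

lemma finite_vertex_pairs [simp]: "finite (vertex_pairs n)"
  by (rule finite_subset[of _ "Pow {1..n}"]) (auto simp: vertex_pairs_def)

lemma image_vertex_pairs:
  assumes "e \<in> vertex_pairs k" "\<beta> \<in> {1..k} \<rightarrow> {1..n}" "inj_on \<beta> {1..k}"
  shows "\<beta> ` e \<in> vertex_pairs n"
  using assms by (auto simp: vertex_pairs_def card_image inj_on_subset)

text \<open>Distinct edges stay distinct in a copy, so a product over the edges of the pattern can
  be reindexed as a product over the edge set of the copy.\<close>

lemma inj_on_image_vertex_pairs:
  assumes "inj_on \<beta> {1..k}"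
  shows "inj_on ((`) \<beta>) (vertex_pairs k)"
  by (rule inj_on_subset[OF inj_on_image_Pow[OF assms]]) (auto simp: vertex_pairs_def)

lemma finite_injections [simp]: "finite (injections k n)"
  by (rule finite_subset[of _ "{1..k} \<rightarrow>\<^sub>E {1..n}"]) (auto simp: injections_def intro: finite_PiE)

lemma card_injections:
  assumes "k \<le> n"
  shows "real (card (injections k n)) = fact n / fact (n - k)"
proof -
  have "card (injections k n) = (\<Prod>i<k. n - i)"
    unfolding injections_def
    by (subst card_inj_on_subset_funcset) (auto simp: atLeast0LessThan)
  also have "real \<dots> = fact n / fact (n - k)"
    using assms
  proof (induction k)
    case (Suc k)
    then have "fact (n - k) = real (n - k) * fact (n - Suc k)"
      by (metis Suc_diff_Suc Suc_le_lessD fact_Suc of_nat_fact of_nat_mult)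
    with Suc show ?case by (simp add: field_simps)
  qed simp
  finally show ?thesis .
qed

text \<open>Both sides are products of \<open>2 * k - 1\<close> descending factors with the same first \<open>k\<close> of them.\<close>

lemma fact_quotient_le_square:
  assumes "k \<ge> 1" "n \<ge> 2 * k - 1"
  shows "fact n / fact (n + 1 - 2 * k) \<le> (fact n / fact (n - k))\<^sup>2 / real n"
proof -
  \<comment> \<open>Each side is a product of \<open>j\<close> descending factors, starting at
    \<open>n - k\<close> and at \<open>n - 1\<close>; \<open>k \<ge> 1\<close> orders them factor by
    factor.\<close>
  have "(fact (n - k) / fact (n - k - j) :: real) \<le> fact (n - 1) / fact (n - 1 - j)"
    if "k + j \<le> n" for j
    using that
  proof (induction j)
    case (Suc j)
    have step: "fact a / fact (b - Suc j) = fact a / fact (b - j) * real (b - j)" if "Suc j \<le> b"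
      for a b :: nat
    proof -
      from that obtain m where "b - j = Suc m" "b - Suc j = m"
        by (metis Suc_diff_Suc Suc_le_lessD)
      then show ?thesis by (simp add: divide_simps del: of_nat_Suc)
    qed
    have "(fact (n - k) / fact (n - k - Suc j) :: real) = fact (n - k) / fact (n - k - j) * real (n - k - j)"
      using Suc.prems by (intro step) auto
    also have "\<dots> \<le> fact (n - 1) / fact (n - 1 - j) * real (n - 1 - j)"
      using Suc assms(1) by (intro mult_mono) auto
    also have "\<dots> = fact (n - 1) / fact (n - 1 - Suc j)"
      using Suc.prems assms(1) by (intro step[symmetric]) auto
    finally show ?case .
  qed simp
  \<comment> \<open>With \<open>j = k - 1\<close> the denominators become
    \<open>(n - k) - (k - 1) = n + 1 - 2 * k\<close> and \<open>(n - 1) - (k - 1) = n - k\<close>.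
    The factor \<open>n\<close> split off from \<open>fact n\<close> below accounts for the division
    by \<open>n\<close>.\<close>
  from this[of "k - 1"] assms
  have "(fact (n - k) / fact (n + 1 - 2 * k) :: real) \<le> fact (n - 1) / fact (n - k)"
    by (simp add: mult_2 Suc_diff_le)
  moreover have "(fact n :: real) = real n * fact (n - 1)"
    using assms by (intro fact_reduce) auto
  ultimately show ?thesis
    using assms by (auto simp: field_simps power2_eq_square)
qed

text \<open>Testing against a multiple \<open>t\<close> of a centred \<open>T\<close> replaces the Hoeffding projection.\<close>

lemma (in prob_space) variance_ge_test:
  fixes U T :: "'a \<Rightarrow> real"
  assumes "integrable M U" "integrable M T" "integrable M (\<lambda>x. (U x)\<^sup>2)" "integrable M (\<lambda>x. (T x)\<^sup>2)"
    and "integrable M (\<lambda>x. U x * T x)" and "expectation T = 0"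
  shows "variance U \<ge> 2 * t * expectation (\<lambda>x. U x * T x) - t\<^sup>2 * expectation (\<lambda>x. (T x)\<^sup>2)"
proof -
  let ?m = "expectation U"
  note [simp] = assms
  have "0 \<le> expectation (\<lambda>x. (U x - ?m - t * T x)\<^sup>2)"
    by simp
  also have "(\<lambda>x. (U x - ?m - t * T x)\<^sup>2)
    = (\<lambda>x. ((U x)\<^sup>2 - 2 * ?m * U x + ?m\<^sup>2) - 2 * t * (U x * T x) + 2 * ?m * t * T x + t\<^sup>2 * (T x)\<^sup>2)"
    by (auto simp: power2_eq_square algebra_simps)
  also have "expectation \<dots> = (expectation (\<lambda>x. (U x)\<^sup>2) - ?m\<^sup>2)
      - 2 * t * expectation (\<lambda>x. U x * T x) + t\<^sup>2 * expectation (\<lambda>x. (T x)\<^sup>2)"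
    by (simp del: power2_diff) (simp add: prob_space power2_eq_square)
  finally show ?thesis
    by (simp add: variance_eq)
qed

section \<open>Bounded functions of independent variables and iterated integrals\<close>

lemma (in prob_space) integrable_bounded:
  fixes F :: "'a \<Rightarrow> real"
  assumes "F \<in> borel_measurable M" "\<And>x. \<bar>F x\<bar> \<le> B"
  shows "integrable M F"
  using assms by (intro integrable_const_bound[where B = B]) auto

text \<open>Disjoint blocks of an independent family are independent as vectors, and so are
  functions of them; the bounds supply integrability.\<close>

lemma (in prob_space) expectation_mult_disjoint:
  fixes F G :: "('i \<Rightarrow> 'b) \<Rightarrow> real"
  assumes "indep_vars N X I" "K \<inter> L = {}" "K \<subseteq> I" "L \<subseteq> I"
    and [measurable]: "F \<in> borel_measurable (Pi\<^sub>M K N)" "G \<in> borel_measurable (Pi\<^sub>M L N)"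
    and "\<And>x. \<bar>F x\<bar> \<le> B" "\<And>x. \<bar>G x\<bar> \<le> C"
  shows "expectation (\<lambda>\<omega>. F (\<lambda>i\<in>K. X i \<omega>) * G (\<lambda>i\<in>L. X i \<omega>))
    = expectation (\<lambda>\<omega>. F (\<lambda>i\<in>K. X i \<omega>)) * expectation (\<lambda>\<omega>. G (\<lambda>i\<in>L. X i \<omega>))"
proof -
  have meas: "(\<lambda>\<omega>. \<lambda>i\<in>J. X i \<omega>) \<in> measurable M (Pi\<^sub>M J N)" if "J \<subseteq> I" for J
    using assms(1) that by (auto simp: indep_vars_def intro!: measurable_restrict)
  have "indep_var borel (F \<circ> (\<lambda>\<omega>. \<lambda>i\<in>K. X i \<omega>)) borel (G \<circ> (\<lambda>\<omega>. \<lambda>i\<in>L. X i \<omega>))"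
    by (rule indep_var_compose[OF indep_var_restrict[OF assms(1-4)]]) measurable
  moreover have "integrable M (F \<circ> (\<lambda>\<omega>. \<lambda>i\<in>K. X i \<omega>))"
    using meas[OF assms(3)] assms(7) by (intro integrable_bounded[of _ B]) auto
  moreover have "integrable M (G \<circ> (\<lambda>\<omega>. \<lambda>i\<in>L. X i \<omega>))"
    using meas[OF assms(4)] assms(8) by (intro integrable_bounded[of _ C]) auto
  ultimately show ?thesis
    unfolding comp_def by (rule indep_var_lebesgue_integral)
qed

text \<open>Fubini moves the distinguished coordinate to the outer integral, so that the inner
  integral has the shape of \<open>rooted_density\<close>.\<close>

lemma integral_PiM_insert_rev:
  fixes F :: "('i \<Rightarrow> 'b) \<Rightarrow> real"
  assumes \<mu>: "prob_space \<mu>" and I: "finite I" "i \<notin> I"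
    and [measurable]: "F \<in> borel_measurable (Pi\<^sub>M (insert i I) (\<lambda>_. \<mu>))" and B: "\<And>x. \<bar>F x\<bar> \<le> B"
  shows "(\<integral>x. F x \<partial>Pi\<^sub>M (insert i I) (\<lambda>_. \<mu>)) = (\<integral>x. (\<integral>y. F (y(i := x)) \<partial>Pi\<^sub>M I (\<lambda>_. \<mu>)) \<partial>\<mu>)"
proof -
  interpret prob_space \<mu> by fact
  interpret product_prob_space "\<lambda>_. \<mu>" by unfold_locales
  interpret PJ: prob_space "Pi\<^sub>M (insert i I) (\<lambda>_. \<mu>)" by (intro prob_space_PiM \<mu>)
  interpret PI: prob_space "Pi\<^sub>M I (\<lambda>_. \<mu>)" by (intro prob_space_PiM \<mu>)
  interpret Q: pair_prob_space \<mu> "Pi\<^sub>M I (\<lambda>_. \<mu>)" ..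
  interpret R: pair_prob_space "Pi\<^sub>M I (\<lambda>_. \<mu>)" \<mu> ..
  have "integrable (Pi\<^sub>M (insert i I) (\<lambda>_. \<mu>)) F"
    by (rule PJ.integrable_bounded[where B = B]) (use B in auto)
  moreover have "integrable (\<mu> \<Otimes>\<^sub>M Pi\<^sub>M I (\<lambda>_. \<mu>)) (\<lambda>(x, y). F (y(i := x)))"
    by (rule Q.P.integrable_bounded[where B = B]) (use B in auto)
  ultimately show ?thesis
    using I by (simp add: product_integral_insert Q.Fubini_integral)
qed

section \<open>Densities of the pattern\<close>

definition copy_weight :: "nat set set \<Rightarrow> ('a \<Rightarrow> 'a \<Rightarrow> real) \<Rightarrow> (nat \<Rightarrow> 'a) \<Rightarrow> real" where
  "copy_weight E H x = (\<Prod>e\<in>E. on_pair H x e)"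

text \<open>This is the homomorphism density of the pattern in the kernel \<open>H\<close>.\<close>

definition copy_density :: "nat \<Rightarrow> nat set set \<Rightarrow> 'a measure \<Rightarrow> ('a \<Rightarrow> 'a \<Rightarrow> real) \<Rightarrow> real" where
  "copy_density k E \<mu> H = (\<integral>y. copy_weight E H y \<partial>Pi\<^sub>M {1..k} (\<lambda>_. \<mu>))"

text \<open>Up to the factor \<open>p ^ card E / num_aut k E\<close> this is \<open>f_proj\<close>;
  without that factor it is free of \<open>p\<close>, and hence the same for all
  \<open>n\<close>.\<close>

definition rooted_density ::
    "nat \<Rightarrow> nat set set \<Rightarrow> 'a measure \<Rightarrow> ('a \<Rightarrow> 'a \<Rightarrow> real) \<Rightarrow> nat \<Rightarrow> 'a \<Rightarrow> real" where
  "rooted_density k E \<mu> H l x = (\<integral>y. copy_weight E H (y(l := x)) \<partial>Pi\<^sub>M ({1..k} - {l}) (\<lambda>_. \<mu>))"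

definition rooted_density_sum ::
    "nat \<Rightarrow> nat set set \<Rightarrow> 'a measure \<Rightarrow> ('a \<Rightarrow> 'a \<Rightarrow> real) \<Rightarrow> 'a \<Rightarrow> real" where
  "rooted_density_sum k E \<mu> H x = (\<Sum>l=1..k. rooted_density k E \<mu> H l x)"

text \<open>In the model, \<open>k * copy_density k E \<mu> H\<close> is the mean of
  \<open>rooted_density_sum\<close> under \<mu>, so this is its variance. Neither \<open>p\<close>
  nor \<open>n\<close> enters, which lets it serve in the constant.\<close>

definition projection_variance ::
    "nat \<Rightarrow> nat set set \<Rightarrow> 'a measure \<Rightarrow> ('a \<Rightarrow> 'a \<Rightarrow> real) \<Rightarrow> real" where
  "projection_variance k E \<mu> H =
     (\<integral>x. (rooted_density_sum k E \<mu> H x - k * copy_density k E \<mu> H)\<^sup>2 \<partial>\<mu>)"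

lemma f_proj_eq: "f_proj k E \<mu> H p l x = p ^ card E / real (num_aut k E) * rooted_density k E \<mu> H l x"
  by (simp add: f_proj_def rooted_density_def copy_weight_def)

text \<open>The model at one fixed \<open>n\<close> together with the pattern. The final theorem
  interprets it once for each \<open>n\<close> while \<open>k\<close>, \<open>E\<close>, \<mu> and
  \<open>H\<close> stay the same, so all instances share the same densities.\<close>

locale rcm_pattern = binomial_rcm M n \<mu> H p X A
  for M :: "'w measure" and n and \<mu> :: "'a::euclidean_space measure" and H p X A +
  fixes k :: nat and E :: "nat set set"
  assumes prob_\<mu>: "prob_space \<mu>" and sets_\<mu> [measurable_cong]: "sets \<mu> = sets borel"
    and H_meas: "(\<lambda>(x, y). H x y) \<in> borel_measurable (borel \<Otimes>\<^sub>M borel)"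
    and H_sym: "H x y = H y x"
    and H_range: "H x y \<in> {0..1}"
    and p_range: "p \<in> {0..1}"
    and graph: "E \<subseteq> vertex_pairs k"
    and n_pos: "n \<ge> 1"
begin

abbreviation "w \<equiv> copy_weight E H"
abbreviation "h \<equiv> copy_density k E \<mu> H"
abbreviation "g \<equiv> rooted_density k E \<mu> H"
abbreviation "G \<equiv> rooted_density_sum k E \<mu> H"
abbreviation "W \<beta> \<omega> \<equiv> w (\<lambda>l. X (\<beta> l) \<omega>)"

section \<open>Measurability and bounds\<close>

sublocale points: prob_space \<mu>
  by (rule prob_\<mu>)

lemma sets_PiM_\<mu> [measurable_cong]: "sets (Pi\<^sub>M K (\<lambda>_. \<mu>)) = sets (Pi\<^sub>M K (\<lambda>_. borel))"
  by (intro sets_PiM_cong) (auto simp: sets_\<mu>)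

text \<open>Measurability sees only the sigma-algebra; this converts between the product of \<mu>,
  needed for integrals, and the product of \<open>borel\<close>, needed for random vectors.\<close>

lemma measurable_PiM_\<mu>:
  "measurable (Pi\<^sub>M K (\<lambda>_. \<mu>)) N = measurable (Pi\<^sub>M K (\<lambda>_. borel)) N"
  "measurable N (Pi\<^sub>M K (\<lambda>_. \<mu>)) = measurable N (Pi\<^sub>M K (\<lambda>_. borel))"
  by (intro measurable_cong_sets sets_PiM_\<mu> refl)+

lemma X_meas [measurable]: "i \<in> {1..n} \<Longrightarrow> random_variable borel (X i)"
  using indep_points by (auto simp: indep_vars_def)

lemma finite_E [simp]: "finite E"
  using finite_subset[OF graph] by simp

lemma on_pair_range: "0 \<le> on_pair H x e" "on_pair H x e \<le> 1"
  using H_range by (auto simp: on_pair_def)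

lemma prod_on_pair_range: "0 \<le> (\<Prod>e\<in>S. on_pair H x e)" "(\<Prod>e\<in>S. on_pair H x e) \<le> 1"
  by (auto intro!: prod_nonneg prod_le_1 on_pair_range)

lemma w_range: "0 \<le> w x" "w x \<le> 1" "\<bar>w x\<bar> \<le> 1"
  using prod_on_pair_range[of x E] by (auto simp: copy_weight_def)

lemma on_pair_meas:
  assumes "e \<in> vertex_pairs m"
  shows "(\<lambda>x. on_pair H x e) \<in> borel_measurable (Pi\<^sub>M {1..m} (\<lambda>_. borel))"
proof -
  from assms obtain u v where uv: "e = {u, v}" "u < v" "u \<in> {1..m}" "v \<in> {1..m}"
    by (rule vertex_pairsE)
  then have "(\<lambda>x. (\<lambda>(a, b). H a b) (x u, x v)) \<in> borel_measurable (Pi\<^sub>M {1..m} (\<lambda>_. borel))"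
    by (intro measurable_compose[OF _ H_meas]) auto
  with uv show ?thesis by simp
qed

lemma w_meas [measurable]: "w \<in> borel_measurable (Pi\<^sub>M {1..k} (\<lambda>_. borel))"
  unfolding copy_weight_def using graph by (intro borel_measurable_prod on_pair_meas) auto

text \<open>All edges lie inside \<open>{1..k}\<close>. This allows passing between a point
  configuration on all of \<open>nat\<close> and its restriction, as product measures
  require.\<close>

lemma w_cong:
  assumes "\<And>i. i \<in> {1..k} \<Longrightarrow> x i = y i"
  shows "w x = w y"
  unfolding copy_weight_def
proof (rule prod.cong)
  fix e assume "e \<in> E"
  with graph obtain u v where "e = {u, v}" "u < v" "u \<in> {1..k}" "v \<in> {1..k}"
    by (metis subsetD vertex_pairsE)
  with assms show "on_pair H x e = on_pair H y e" by auto
qed simp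

lemma w_restrict [simp]: "w (restrict x {Suc 0..k}) = w x"
  by (rule w_cong) auto

section \<open>Moments of a single copy\<close>

lemma integral_X:
  fixes F :: "(nat \<Rightarrow> 'a) \<Rightarrow> real"
  assumes \<beta>: "\<beta> \<in> K \<rightarrow> {1..n}" "inj_on \<beta> K"
    and F: "F \<in> borel_measurable (Pi\<^sub>M K (\<lambda>_. borel))"
  shows "expectation (\<lambda>\<omega>. F (\<lambda>i\<in>K. X (\<beta> i) \<omega>)) = (\<integral>y. F y \<partial>Pi\<^sub>M K (\<lambda>_. \<mu>))"
proof -
  have XI: "(\<lambda>\<omega>. \<lambda>i\<in>{1..n}. X i \<omega>) \<in> measurable M (Pi\<^sub>M {1..n} (\<lambda>_. borel))"
    by (intro measurable_restrict) auto
  have "(\<Pi>\<^sub>M i\<in>{1..n}. distr M borel (X i)) = Pi\<^sub>M {1..n} (\<lambda>_. \<mu>)"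
    by (intro PiM_cong) (auto simp: distr_points)
  \<comment> \<open>Independence is equivalent to the joint law being the product of the marginals;
    \<open>n_pos\<close> makes the index set nonempty for this characterization.\<close>
  with indep_points n_pos have law:
    "distr M (Pi\<^sub>M {1..n} (\<lambda>_. borel)) (\<lambda>\<omega>. \<lambda>i\<in>{1..n}. X i \<omega>) = Pi\<^sub>M {1..n} (\<lambda>_. \<mu>)"
    by (subst (asm) indep_vars_iff_distr_eq_PiM') auto
  have re: "(\<lambda>x. \<lambda>i\<in>K. x (\<beta> i)) \<in> measurable (Pi\<^sub>M {1..n} (\<lambda>_. borel)) (Pi\<^sub>M K (\<lambda>_. borel))"
    using \<beta> by (intro measurable_restrict measurable_component_singleton) auto
  have eq: "(\<lambda>i\<in>K. (\<lambda>i\<in>{1..n}. X i \<omega>) (\<beta> i)) = (\<lambda>i\<in>K. X (\<beta> i) \<omega>)" for \<omega>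
    using \<beta>(1) by (intro restrict_ext restrict_apply') (rule Pi_mem)
  \<comment> \<open>Selecting coordinates along an injection maps a product of identical factors to
    the product over the smaller index set.\<close>
  have "(\<integral>y. F y \<partial>Pi\<^sub>M K (\<lambda>_. \<mu>))
      = (\<integral>y. F y \<partial>distr (Pi\<^sub>M {1..n} (\<lambda>_. \<mu>)) (Pi\<^sub>M K (\<lambda>_. \<mu>)) (\<lambda>x. \<lambda>i\<in>K. x (\<beta> i)))"
    using \<beta> by (subst distr_PiM_reindex) (auto simp: prob_\<mu>)
  also have "\<dots> = (\<integral>x. F (\<lambda>i\<in>K. x (\<beta> i)) \<partial>Pi\<^sub>M {1..n} (\<lambda>_. \<mu>))"
    by (rule integral_distr) (simp_all only: measurable_PiM_\<mu> re F)
  also have "\<dots> = expectation (\<lambda>\<omega>. F (\<lambda>i\<in>K. (\<lambda>i\<in>{1..n}. X i \<omega>) (\<beta> i)))"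
    unfolding law[symmetric] by (rule integral_distr[OF XI measurable_compose[OF re F]])
  finally show ?thesis
    unfolding eq by (rule sym)
qed

lemma integral_X_single:
  fixes \<phi> :: "'a \<Rightarrow> real"
  assumes "i \<in> {1..n}" and [measurable]: "\<phi> \<in> borel_measurable borel"
  shows "expectation (\<lambda>\<omega>. \<phi> (X i \<omega>)) = (\<integral>x. \<phi> x \<partial>\<mu>)"
  using assms by (subst distr_points[symmetric, of i]) (auto simp: integral_distr)

lemma W_restrict: "W \<beta> \<omega> = w (\<lambda>l\<in>{1..k}. X (\<beta> l) \<omega>)"
  by simp

lemma W_meas [measurable]:
  assumes "\<beta> \<in> {1..k} \<rightarrow> {1..n}"
  shows "random_variable borel (W \<beta>)"
  unfolding W_restrict using assms
  by (intro measurable_compose[OF _ w_meas] measurable_restrict X_meas) auto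

lemma expectation_W:
  assumes "\<beta> \<in> {1..k} \<rightarrow> {1..n}" "inj_on \<beta> {1..k}"
  shows "expectation (W \<beta>) = h"
  unfolding W_restrict copy_density_def using assms by (rule integral_X) measurable

lemma rooted_meas: "(\<lambda>(x, y). w (y(l := x))) \<in> borel_measurable (borel \<Otimes>\<^sub>M Pi\<^sub>M ({1..k} - {l}) (\<lambda>_. \<mu>))"
  if "l \<in> {1..k}"
proof -
  have "(\<lambda>(x, y). y(l := x)) \<in> measurable (borel \<Otimes>\<^sub>M Pi\<^sub>M ({1..k} - {l}) (\<lambda>_. borel)) (Pi\<^sub>M (insert l ({1..k} - {l})) (\<lambda>_. borel))"
    by measurable
  moreover have "insert l ({1..k} - {l}) = {1..k}"
    using that by auto
  ultimately have "(\<lambda>z. w ((\<lambda>(x, y). y(l := x)) z)) \<in> borel_measurable (borel \<Otimes>\<^sub>M Pi\<^sub>M ({1..k} - {l}) (\<lambda>_. borel))"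
    by (intro measurable_compose[OF _ w_meas]) auto
  then show ?thesis
    by (simp add: case_prod_beta' cong: measurable_cong_sets)
qed

lemma g_meas [measurable]: "l \<in> {1..k} \<Longrightarrow> g l \<in> borel_measurable borel"
proof -
  assume l: "l \<in> {1..k}"
  interpret PL: prob_space "Pi\<^sub>M ({1..k} - {l}) (\<lambda>_. \<mu>)" by (intro prob_space_PiM prob_\<mu>)
  show ?thesis
    unfolding rooted_density_def using rooted_meas[OF l]
    by (intro PL.borel_measurable_lebesgue_integral) auto
qed

lemma g_range:
  assumes l: "l \<in> {1..k}"
  shows "0 \<le> g l x" "g l x \<le> 1"
proof -
  interpret PL: prob_space "Pi\<^sub>M ({1..k} - {l}) (\<lambda>_. \<mu>)" by (intro prob_space_PiM prob_\<mu>)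
  show "0 \<le> g l x" unfolding rooted_density_def by (simp add: w_range)
  have "(\<lambda>y. w (y(l := x))) \<in> borel_measurable (Pi\<^sub>M ({1..k} - {l}) (\<lambda>_. \<mu>))"
    using measurable_compose[OF measurable_Pair1' rooted_meas[OF l], of x] by simp
  then have "integrable (Pi\<^sub>M ({1..k} - {l}) (\<lambda>_. \<mu>)) (\<lambda>y. w (y(l := x)))"
    by (rule PL.integrable_bounded[where B = 1]) (rule w_range)
  then show "g l x \<le> 1" unfolding rooted_density_def
    by (rule PL.integral_le_const) (simp add: w_range)
qed

lemma G_meas [measurable]: "G \<in> borel_measurable borel"
  unfolding rooted_density_sum_def by measurable

lemma G_range: "0 \<le> G x" "\<bar>G x\<bar> \<le> k"
proof -
  show "0 \<le> G x"
    unfolding rooted_density_sum_def by (intro sum_nonneg g_range(1))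
  moreover have "G x \<le> (\<Sum>l=1..k. 1)"
    unfolding rooted_density_sum_def by (intro sum_mono g_range(2))
  ultimately show "\<bar>G x\<bar> \<le> k" by simp
qed

text \<open>Integrating out all points of the copy except the one at position \<open>l\<close>
  leaves \<open>g l\<close>, which acts as the conditional mean of the weight given that
  point.\<close>

lemma expectation_W_mult_vertex:
  fixes \<phi> :: "'a \<Rightarrow> real"
  assumes \<beta>: "\<beta> \<in> {1..k} \<rightarrow> {1..n}" "inj_on \<beta> {1..k}" and l: "l \<in> {1..k}"
    and [measurable]: "\<phi> \<in> borel_measurable borel" and B: "\<And>x. \<bar>\<phi> x\<bar> \<le> B"
  shows "expectation (\<lambda>\<omega>. W \<beta> \<omega> * \<phi> (X (\<beta> l) \<omega>)) = (\<integral>x. g l x * \<phi> x \<partial>\<mu>)"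
proof -
  have ins: "insert l ({1..k} - {l}) = {1..k}" using l by auto
  have "expectation (\<lambda>\<omega>. W \<beta> \<omega> * \<phi> (X (\<beta> l) \<omega>)) =
      expectation (\<lambda>\<omega>. (\<lambda>y. w y * \<phi> (y l)) (\<lambda>i\<in>{1..k}. X (\<beta> i) \<omega>))"
    using l by simp
  also have "\<dots> = (\<integral>y. w y * \<phi> (y l) \<partial>Pi\<^sub>M {1..k} (\<lambda>_. \<mu>))"
    using \<beta> l by (intro integral_X) measurable
  also have "\<dots> = (\<integral>y. w y * \<phi> (y l) \<partial>Pi\<^sub>M (insert l ({1..k} - {l})) (\<lambda>_. \<mu>))"
    by (simp only: ins)
  also have "\<dots> = (\<integral>x. (\<integral>y. w (y(l := x)) * \<phi> ((y(l := x)) l) \<partial>Pi\<^sub>M ({1..k} - {l}) (\<lambda>_. \<mu>)) \<partial>\<mu>)"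
  proof (rule integral_PiM_insert_rev[OF prob_\<mu>, where B = B])
    show "(\<lambda>y. w y * \<phi> (y l)) \<in> borel_measurable (Pi\<^sub>M (insert l ({1..k} - {l})) (\<lambda>_. \<mu>))"
      unfolding ins using l by measurable
    show "\<bar>w x * \<phi> (x l)\<bar> \<le> B" for x
      using mult_mono[OF w_range(3)[of x] B[of "x l"]] by (simp add: abs_mult)
  qed auto
  also have "\<dots> = (\<integral>x. g l x * \<phi> x \<partial>\<mu>)"
    by (simp add: rooted_density_def)
  finally show ?thesis .
qed

text \<open>Take the constant test function 1 and the identity as the copy; \<open>k \<le> n\<close>
  makes the identity a map into \<open>{1..n}\<close>.\<close>

lemma integral_g: "k \<le> n \<Longrightarrow> l \<in> {1..k} \<Longrightarrow> (\<integral>x. g l x \<partial>\<mu>) = h"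
  using expectation_W_mult_vertex[of "\<lambda>l. l" l "\<lambda>_. 1" 1] expectation_W[of "\<lambda>l. l"]
  by (auto simp: Pi_iff inj_on_def)

text \<open>A point outside the copy is independent of the points in it.\<close>

lemma expectation_W_mult_other:
  fixes \<phi> :: "'a \<Rightarrow> real"
  assumes \<beta>: "\<beta> \<in> {1..k} \<rightarrow> {1..n}" "inj_on \<beta> {1..k}" and i: "i \<in> {1..n} - \<beta> ` {1..k}"
    and [measurable]: "\<phi> \<in> borel_measurable borel" and B: "\<And>x. \<bar>\<phi> x\<bar> \<le> B"
  shows "expectation (\<lambda>\<omega>. W \<beta> \<omega> * \<phi> (X i \<omega>)) = h * (\<integral>x. \<phi> x \<partial>\<mu>)"
proof -
  \<comment> \<open>The weight is read as a function of the block indexed by the image of \<beta>,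
    to be separated from the one-point block \<open>{i}\<close>.\<close>
  have "(\<lambda>x. w (\<lambda>l\<in>{1..k}. x (\<beta> l))) \<in> borel_measurable (Pi\<^sub>M (\<beta> ` {1..k}) (\<lambda>_. borel))"
    by (intro measurable_compose[OF _ w_meas] measurable_restrict measurable_component_singleton) auto
  then have "expectation (\<lambda>\<omega>. w (\<lambda>l\<in>{1..k}. (\<lambda>j\<in>\<beta> ` {1..k}. X j \<omega>) (\<beta> l)) * \<phi> ((\<lambda>j\<in>{i}. X j \<omega>) i))
     = expectation (\<lambda>\<omega>. w (\<lambda>l\<in>{1..k}. (\<lambda>j\<in>\<beta> ` {1..k}. X j \<omega>) (\<beta> l))) * expectation (\<lambda>\<omega>. \<phi> ((\<lambda>j\<in>{i}. X j \<omega>) i))"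
    using i \<beta> B w_range(3)
    by (intro expectation_mult_disjoint[OF indep_points, of "\<beta> ` {1..k}" "{i}"
          "\<lambda>x. w (\<lambda>l\<in>{1..k}. x (\<beta> l))" "\<lambda>x. \<phi> (x i)" 1 B]) auto
  moreover have "w (\<lambda>l\<in>{1..k}. (\<lambda>j\<in>\<beta> ` {1..k}. X j \<omega>) (\<beta> l)) = W \<beta> \<omega>" for \<omega>
    by (rule w_cong) auto
  ultimately show ?thesis
    using i by (simp add: expectation_W[OF \<beta>] integral_X_single)
qed

section \<open>The first-order projection and the variance of the weight sum\<close>

abbreviation "\<sigma>2 \<equiv> projection_variance k E \<mu> H"
abbreviation "\<phi> x \<equiv> G x - k * h"
abbreviation "U \<omega> \<equiv> \<Sum>\<beta>\<in>injections k n. W \<beta> \<omega>"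
abbreviation "T \<omega> \<equiv> \<Sum>i=1..n. \<phi> (X i \<omega>)"
abbreviation "num_copies \<equiv> real (card (injections k n))"

lemma \<phi>_bound: "\<bar>\<phi> x\<bar> \<le> k + k * \<bar>h\<bar>"
  using abs_triangle_ineq4[of "G x" "k * h"] G_range(2)[of x] by (simp add: abs_mult)

lemma g_integrable [simp]: "l \<in> {1..k} \<Longrightarrow> integrable \<mu> (g l)"
  using g_range by (intro points.integrable_bounded[where B = 1]) auto

lemma G_integrable [simp]: "integrable \<mu> G"
  using G_range by (intro points.integrable_bounded[where B = k]) auto

lemma \<phi>_sq_integrable [simp]: "integrable \<mu> (\<lambda>x. (\<phi> x)\<^sup>2)"
proof (rule points.integrable_bounded)
  show "\<bar>(\<phi> x)\<^sup>2\<bar> \<le> (k + k * \<bar>h\<bar>)\<^sup>2" for x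
    using power_mono[OF \<phi>_bound[of x], of 2] by simp
qed measurable

lemma integral_\<phi>:
  assumes "k \<le> n"
  shows "(\<integral>x. \<phi> x \<partial>\<mu>) = 0"
proof -
  have "(\<integral>x. G x \<partial>\<mu>) = (\<Sum>l=1..k. \<integral>x. g l x \<partial>\<mu>)"
    unfolding rooted_density_sum_def by (rule Bochner_Integration.integral_sum) auto
  also have "\<dots> = k * h"
    using assms by (simp add: integral_g)
  finally show ?thesis
    by (simp add: points.prob_space)
qed

text \<open>\<open>G\<close> and \<phi> differ by the constant \<open>k * h\<close>, which is
  orthogonal to the centred \<phi>.\<close>

lemma integral_G_mult_\<phi>:
  assumes "k \<le> n"
  shows "(\<integral>x. G x * \<phi> x \<partial>\<mu>) = \<sigma>2"
proof -
  have "(\<integral>x. G x * \<phi> x \<partial>\<mu>) = (\<integral>x. (\<phi> x)\<^sup>2 + k * h * \<phi> x \<partial>\<mu>)"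
    by (intro Bochner_Integration.integral_cong) (auto simp: power2_eq_square algebra_simps)
  also have "\<dots> = \<sigma>2 + k * h * (\<integral>x. \<phi> x \<partial>\<mu>)"
    unfolding projection_variance_def
    by (subst Bochner_Integration.integral_add) (auto simp del: Bochner_Integration.integral_diff)
  finally show ?thesis
    using integral_\<phi>[OF assms] by simp
qed

text \<open>If \<open>h\<close> vanished, the nonnegative \<open>G\<close> would have integral
  \<open>k * h = 0\<close>, hence be zero almost everywhere, and \<sigma>2 would vanish too.
  Positivity of \<open>h\<close> is needed for that of the final constant.\<close>

lemma density_pos:
  assumes "k \<le> n" "\<sigma>2 > 0"
  shows "h > 0"
proof (rule ccontr)
  assume "\<not> h > 0"
  moreover have "h \<ge> 0"
    unfolding copy_density_def by (simp add: w_range)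
  ultimately have [simp]: "h = 0" by simp
  have "(\<integral>x. G x \<partial>\<mu>) = 0"
    using integral_\<phi>[OF assms(1)] by simp
  then have "AE x in \<mu>. G x = 0"
    by (subst (asm) integral_nonneg_eq_0_iff_AE) (auto simp: G_range)
  then have "(\<integral>x. G x * \<phi> x \<partial>\<mu>) = 0"
    by (intro integral_eq_zero_AE) auto
  with assms(2) show False
    unfolding integral_G_mult_\<phi>[OF assms(1)] by simp
qed

lemma integrable_W [simp]: "\<beta> \<in> {1..k} \<rightarrow> {1..n} \<Longrightarrow> integrable M (W \<beta>)"
  using w_range by (intro integrable_bounded[where B = 1]) auto

lemma integrable_W_mult_\<phi>:
  assumes "\<beta> \<in> {1..k} \<rightarrow> {1..n}" "i \<in> {1..n}"
  shows "integrable M (\<lambda>\<omega>. W \<beta> \<omega> * \<phi> (X i \<omega>))"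
proof (rule integrable_bounded)
  show "\<bar>W \<beta> \<omega> * \<phi> (X i \<omega>)\<bar> \<le> 1 * (k + k * \<bar>h\<bar>)" for \<omega>
    unfolding abs_mult by (intro mult_mono \<phi>_bound w_range) auto
qed (use assms in measurable)

lemma integrable_\<phi>_mult_\<phi>:
  assumes "i \<in> {1..n}" "j \<in> {1..n}"
  shows "integrable M (\<lambda>\<omega>. \<phi> (X i \<omega>) * \<phi> (X j \<omega>))"
proof (rule integrable_bounded)
  show "\<bar>\<phi> (X i \<omega>) * \<phi> (X j \<omega>)\<bar> \<le> (k + k * \<bar>h\<bar>) * (k + k * \<bar>h\<bar>)" for \<omega>
    unfolding abs_mult by (intro mult_mono \<phi>_bound) auto
qed (use assms in measurable)

lemma integrable_W_mult_W:
  assumes "\<beta> \<in> {1..k} \<rightarrow> {1..n}" "\<gamma> \<in> {1..k} \<rightarrow> {1..n}"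
  shows "integrable M (\<lambda>\<omega>. W \<beta> \<omega> * W \<gamma> \<omega>)"
proof (rule integrable_bounded)
  show "\<bar>W \<beta> \<omega> * W \<gamma> \<omega>\<bar> \<le> 1 * 1" for \<omega>
    unfolding abs_mult by (intro mult_mono w_range) auto
qed (use assms in measurable)

lemma injectionsD:
  assumes "\<beta> \<in> injections k n"
  shows "\<beta> \<in> {1..k} \<rightarrow> {1..n}" "inj_on \<beta> {1..k}"
  using assms by (auto simp: injections_def)

text \<open>Only the \<open>k\<close> points used by the copy correlate with its weight. Position
  \<open>l\<close> contributes the integral of \<open>g l\<close> times \<phi>, and summing over
  positions turns \<open>g l\<close> into \<open>G\<close>.\<close>

lemma expectation_W_mult_T:
  assumes "k \<le> n" and \<beta>: "\<beta> \<in> {1..k} \<rightarrow> {1..n}" "inj_on \<beta> {1..k}"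
  shows "expectation (\<lambda>\<omega>. W \<beta> \<omega> * T \<omega>) = \<sigma>2"
proof -
  have "expectation (\<lambda>\<omega>. W \<beta> \<omega> * T \<omega>) = (\<Sum>i=1..n. expectation (\<lambda>\<omega>. W \<beta> \<omega> * \<phi> (X i \<omega>)))"
    unfolding sum_distrib_left
    using \<beta> by (intro Bochner_Integration.integral_sum integrable_W_mult_\<phi>) auto
  also have "\<dots> = (\<Sum>i\<in>\<beta> ` {1..k}. expectation (\<lambda>\<omega>. W \<beta> \<omega> * \<phi> (X i \<omega>)))"
  proof (rule sum.mono_neutral_right)
    show "\<forall>i\<in>{1..n} - \<beta> ` {1..k}. expectation (\<lambda>\<omega>. W \<beta> \<omega> * \<phi> (X i \<omega>)) = 0"
    proof
      fix i assume i: "i \<in> {1..n} - \<beta> ` {1..k}"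
      have "expectation (\<lambda>\<omega>. W \<beta> \<omega> * \<phi> (X i \<omega>)) = h * (\<integral>x. \<phi> x \<partial>\<mu>)"
        by (rule expectation_W_mult_other[OF \<beta> i _ \<phi>_bound]) measurable
      then show "expectation (\<lambda>\<omega>. W \<beta> \<omega> * \<phi> (X i \<omega>)) = 0"
        by (simp only: integral_\<phi>[OF assms(1)])
    qed
  qed (use \<beta> in auto)
  also have "\<dots> = (\<Sum>l=1..k. expectation (\<lambda>\<omega>. W \<beta> \<omega> * \<phi> (X (\<beta> l) \<omega>)))"
    using \<beta> by (simp add: sum.reindex)
  also have "\<dots> = (\<Sum>l=1..k. \<integral>x. g l x * \<phi> x \<partial>\<mu>)"
    using \<beta> by (intro sum.cong expectation_W_mult_vertex[OF _ _ _ _ \<phi>_bound]) auto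
  also have "\<dots> = (\<integral>x. (\<Sum>l=1..k. g l x * \<phi> x) \<partial>\<mu>)"
  proof (rule Bochner_Integration.integral_sum[symmetric])
    fix l assume l: "l \<in> {1..k}"
    show "integrable \<mu> (\<lambda>x. g l x * \<phi> x)"
    proof (rule points.integrable_bounded)
      show "\<bar>g l x * \<phi> x\<bar> \<le> 1 * (k + k * \<bar>h\<bar>)" for x
        unfolding abs_mult using g_range[OF l, of x] by (intro mult_mono \<phi>_bound) auto
    qed (use l in measurable)
  qed
  also have "(\<lambda>x. \<Sum>l=1..k. g l x * \<phi> x) = (\<lambda>x. G x * \<phi> x)"
    unfolding sum_distrib_right[symmetric] rooted_density_sum_def ..
  finally show ?thesis
    by (simp only: integral_G_mult_\<phi>[OF assms(1)])
qed

text \<open>The summands of \<open>T\<close> are independent and centred, so only the diagonal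
  survives.\<close>

lemma expectation_T_sq:
  assumes "k \<le> n"
  shows "expectation (\<lambda>\<omega>. (T \<omega>)\<^sup>2) = n * \<sigma>2"
proof -
  have E: "expectation (\<lambda>\<omega>. \<phi> (X i \<omega>) * \<phi> (X j \<omega>)) = (if i = j then \<sigma>2 else 0)"
    if ij: "i \<in> {1..n}" "j \<in> {1..n}" for i j
  proof (cases "i = j")
    case True
    have "expectation (\<lambda>\<omega>. (\<lambda>x. (\<phi> x)\<^sup>2) (X i \<omega>)) = \<sigma>2"
      unfolding projection_variance_def using ij by (intro integral_X_single) auto
    with True show ?thesis by (simp add: power2_eq_square)
  next
    case False
    have "expectation (\<lambda>\<omega>. \<phi> ((\<lambda>a\<in>{i}. X a \<omega>) i) * \<phi> ((\<lambda>a\<in>{j}. X a \<omega>) j))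
      = expectation (\<lambda>\<omega>. \<phi> ((\<lambda>a\<in>{i}. X a \<omega>) i)) * expectation (\<lambda>\<omega>. \<phi> ((\<lambda>a\<in>{j}. X a \<omega>) j))"
      using ij False
      by (intro expectation_mult_disjoint[OF indep_points _ _ _ _ _ \<phi>_bound \<phi>_bound,
            of "{i}" "{j}" "\<lambda>y. y i" "\<lambda>y. y j"]) auto
    moreover have "expectation (\<lambda>\<omega>. \<phi> (X i \<omega>)) = 0"
      using integral_X_single[of i \<phi>] ij integral_\<phi>[OF assms] by (simp only:) measurable
    ultimately show ?thesis
      using False by simp
  qed
  have "expectation (\<lambda>\<omega>. (T \<omega>)\<^sup>2) = expectation (\<lambda>\<omega>. \<Sum>i=1..n. \<Sum>j=1..n. \<phi> (X i \<omega>) * \<phi> (X j \<omega>))"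
    by (simp only: power2_eq_square sum_product)
  also have "\<dots> = (\<Sum>i=1..n. \<Sum>j=1..n. expectation (\<lambda>\<omega>. \<phi> (X i \<omega>) * \<phi> (X j \<omega>)))"
    by (subst Bochner_Integration.integral_sum)
       (intro sum.cong refl Bochner_Integration.integral_sum
         Bochner_Integration.integrable_sum integrable_\<phi>_mult_\<phi>; assumption)+
  also have "\<dots> = (\<Sum>i=1..n. \<Sum>j=1..n. if i = j then \<sigma>2 else 0)"
    by (intro sum.cong refl E)
  finally show ?thesis by simp
qed

lemma expectation_U:
  "expectation U = num_copies * h"
proof -
  have "expectation U = (\<Sum>\<beta>\<in>injections k n. expectation (W \<beta>))"
    by (intro Bochner_Integration.integral_sum integrable_W injectionsD)
  also have "\<dots> = (\<Sum>\<beta>\<in>injections k n. h)"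
    by (intro sum.cong refl expectation_W injectionsD)
  finally show ?thesis by simp
qed

lemma integrable_U_sq: "integrable M (\<lambda>\<omega>. (U \<omega>)\<^sup>2)"
  unfolding power2_eq_square sum_product
  by (intro Bochner_Integration.integrable_sum integrable_W_mult_W injectionsD)

lemma variance_U_ge:
  assumes "k \<le> n"
  shows "variance U \<ge> num_copies\<^sup>2 / n * \<sigma>2"
proof -
  have int: "integrable M U"
    by (intro Bochner_Integration.integrable_sum integrable_W injectionsD)
  have intWT: "integrable M (\<lambda>\<omega>. W \<beta> \<omega> * T \<omega>)" if "\<beta> \<in> injections k n" for \<beta>
    unfolding sum_distrib_left
    using that by (intro Bochner_Integration.integrable_sum integrable_W_mult_\<phi> injectionsD)
  have intT: "integrable M (\<lambda>\<omega>. \<phi> (X i \<omega>))" if "i \<in> {1..n}" for i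
    using that by (intro integrable_bounded[OF _ \<phi>_bound]) measurable
  have UT: "expectation (\<lambda>\<omega>. U \<omega> * T \<omega>) = num_copies * \<sigma>2"
  proof -
    have "expectation (\<lambda>\<omega>. U \<omega> * T \<omega>) = (\<Sum>\<beta>\<in>injections k n. expectation (\<lambda>\<omega>. W \<beta> \<omega> * T \<omega>))"
      by (subst sum_distrib_right) (intro Bochner_Integration.integral_sum intWT)
    also have "\<dots> = (\<Sum>\<beta>\<in>injections k n. \<sigma>2)"
      by (intro sum.cong refl expectation_W_mult_T assms injectionsD)
    finally show ?thesis by simp
  qed
  have T0: "expectation T = 0"
  proof -
    have "expectation T = (\<Sum>i=1..n. expectation (\<lambda>\<omega>. \<phi> (X i \<omega>)))"
      by (intro Bochner_Integration.integral_sum intT)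
    also have "\<dots> = (\<Sum>i=1..n. \<integral>x. \<phi> x \<partial>\<mu>)"
      by (intro sum.cong refl integral_X_single) measurable
    finally show ?thesis
      by (simp only: integral_\<phi>[OF assms]) simp
  qed
  have "integrable M (\<lambda>\<omega>. (T \<omega>)\<^sup>2)"
    unfolding power2_eq_square sum_product
    by (intro Bochner_Integration.integrable_sum integrable_\<phi>_mult_\<phi>)
  moreover have "integrable M (\<lambda>\<omega>. U \<omega> * T \<omega>)"
    by (subst sum_distrib_right) (intro Bochner_Integration.integrable_sum intWT)
  moreover have "integrable M T"
    by (intro Bochner_Integration.integrable_sum intT)
  \<comment> \<open>The multiple \<open>t = num_copies / n\<close> is the optimal one: it is the
    quotient of \<open>E[U T] = num_copies * \<sigma>2\<close> by
    \<open>E[T^2] = n * \<sigma>2\<close>.\<close>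
  ultimately have "variance U \<ge> 2 * (num_copies / n) * expectation (\<lambda>\<omega>. U \<omega> * T \<omega>)
      - (num_copies / n)\<^sup>2 * expectation (\<lambda>\<omega>. (T \<omega>)\<^sup>2)"
    using T0 int integrable_U_sq by (intro variance_ge_test)
  also have "2 * (num_copies / n) * expectation (\<lambda>\<omega>. U \<omega> * T \<omega>)
      - (num_copies / n)\<^sup>2 * expectation (\<lambda>\<omega>. (T \<omega>)\<^sup>2) = num_copies\<^sup>2 / n * \<sigma>2"
    unfolding UT expectation_T_sq[OF assms] using n_pos
    by (simp add: field_simps power2_eq_square)
  finally show ?thesis .
qed

section \<open>Edge indicators and their mixed moments\<close>

abbreviation "\<xi> \<beta> \<omega> \<equiv> \<Prod>e\<in>E. indicator (A (\<beta> ` e)) \<omega> :: real"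

text \<open>Tower property: the indicator product is replaced by its conditional expectation given
  the points, and each of the distinct edges contributes one factor \<open>p\<close>.\<close>

lemma expectation_edges:
  assumes S: "S \<subseteq> vertex_pairs n"
  shows "expectation (\<lambda>\<omega>. \<Prod>e\<in>S. indicator (A e) \<omega>)
    = p ^ card S * expectation (\<lambda>\<omega>. \<Prod>e\<in>S. on_pair H (\<lambda>i. X i \<omega>) e)"
proof -
  let ?V = "\<lambda>\<omega>. \<lambda>i\<in>{1..n}. X i \<omega>"
  let ?F = "vimage_algebra (space M) ?V (Pi\<^sub>M {1..n} (\<lambda>_. borel))"
  have V: "?V \<in> measurable M (Pi\<^sub>M {1..n} (\<lambda>_. borel))"
    by (intro measurable_restrict) auto
  then have "sets ?F \<subseteq> sets M"
    by (intro sets_image_in_sets) auto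
  then interpret finite_measure_subalgebra M ?F
    by unfold_locales (auto simp: subalgebra_def)
  have [measurable]: "A e \<in> events" if "e \<in> S" for e
    using that S edge_events by auto
  have "(\<lambda>\<omega>. on_pair H (?V \<omega>) e) \<in> borel_measurable M" if "e \<in> S" for e
    using that S by (intro measurable_compose[OF V on_pair_meas]) auto
  moreover have "on_pair H (?V \<omega>) e = on_pair H (\<lambda>i. X i \<omega>) e" if "e \<in> S" for e \<omega>
  proof -
    from that S obtain u v where "e = {u, v}" "u < v" "u \<in> {1..n}" "v \<in> {1..n}"
      by (metis subsetD vertex_pairsE)
    then show ?thesis by simp
  qed
  ultimately have [measurable]: "(\<lambda>\<omega>. on_pair H (\<lambda>i. X i \<omega>) e) \<in> borel_measurable M" if "e \<in> S" for e
    using that by simp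
  have "integrable M (\<lambda>\<omega>. \<Prod>e\<in>S. indicator (A e) \<omega> :: real)"
    by (rule integrable_bounded[where B = 1]) (auto simp: abs_prod intro!: prod_le_1 split: split_indicator)
  then have "expectation (\<lambda>\<omega>. \<Prod>e\<in>S. indicator (A e) \<omega>)
      = expectation (real_cond_exp M ?F (\<lambda>\<omega>. \<Prod>e\<in>S. indicator (A e) \<omega>))"
    by (rule real_cond_exp_int(2)[symmetric])
  also have "\<dots> = expectation (\<lambda>\<omega>. \<Prod>e\<in>S. p * on_pair H (\<lambda>i. X i \<omega>) e)"
    using cond_indep_edges[OF S] by (intro integral_cong_AE) measurable
  finally show ?thesis
    by (simp add: prod.distrib)
qed

lemma copy_edges:
  assumes "\<beta> \<in> injections k n"
  shows "(`) \<beta> ` E \<subseteq> vertex_pairs n" "inj_on ((`) \<beta>) E"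
  using graph image_vertex_pairs[OF _ injectionsD[OF assms]]
    inj_on_subset[OF inj_on_image_vertex_pairs[OF injectionsD(2)[OF assms]]] by auto

lemma \<xi>_eq:
  assumes "\<beta> \<in> injections k n"
  shows "\<xi> \<beta> \<omega> = (\<Prod>e\<in>(`) \<beta> ` E. indicator (A e) \<omega>)"
  using copy_edges(2)[OF assms] by (simp add: prod.reindex)

text \<open>Written over the edge set of the copy, the weights of two copies can be compared through
  the union and intersection of their edge sets.\<close>

lemma W_eq:
  assumes "\<beta> \<in> injections k n"
  shows "W \<beta> \<omega> = (\<Prod>e\<in>(`) \<beta> ` E. on_pair H (\<lambda>i. X i \<omega>) e)"
proof -
  have "on_pair H (\<lambda>i. X i \<omega>) (\<beta> ` e) = on_pair H (\<lambda>l. X (\<beta> l) \<omega>) e" if "e \<in> E" for e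
  proof -
    from that graph obtain u v where uv: "e = {u, v}" "u < v" "u \<in> {1..k}" "v \<in> {1..k}"
      by (metis subsetD vertex_pairsE)
    then have "\<beta> u \<noteq> \<beta> v"
      using injectionsD(2)[OF assms] by (metis inj_onD nat_neq_iff)
    with uv show ?thesis
      using on_pair_doubleton[OF H_sym] by simp
  qed
  then show ?thesis
    using copy_edges(2)[OF assms] by (simp add: prod.reindex copy_weight_def)
qed

lemma integrable_W_prod:
  assumes "S \<subseteq> vertex_pairs n"
  shows "integrable M (\<lambda>\<omega>. \<Prod>e\<in>S. on_pair H (\<lambda>i. X i \<omega>) e)"
proof (rule integrable_bounded)
  show "\<bar>\<Prod>e\<in>S. on_pair H (\<lambda>i. X i \<omega>) e\<bar> \<le> 1" for \<omega>
    using prod_on_pair_range by simp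
  show "(\<lambda>\<omega>. \<Prod>e\<in>S. on_pair H (\<lambda>i. X i \<omega>) e) \<in> borel_measurable M"
  proof (rule borel_measurable_prod)
    fix e assume "e \<in> S"
    then obtain u v where uv: "e = {u, v}" "u < v" "u \<in> {1..n}" "v \<in> {1..n}"
      using assms by (metis subsetD vertex_pairsE)
    then have "(\<lambda>\<omega>. (\<lambda>(a, b). H a b) (X u \<omega>, X v \<omega>)) \<in> borel_measurable M"
      by (intro measurable_compose[OF _ H_meas]) auto
    with uv show "(\<lambda>\<omega>. on_pair H (\<lambda>i. X i \<omega>) e) \<in> borel_measurable M" by simp
  qed
qed

lemma \<xi>_meas:
  assumes "\<beta> \<in> injections k n"
  shows "\<xi> \<beta> \<in> borel_measurable M"
  using copy_edges(1)[OF assms]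
  by (intro borel_measurable_prod borel_measurable_indicator edge_events) auto

lemma \<xi>_range: "0 \<le> \<xi> \<beta> \<omega>" "\<xi> \<beta> \<omega> \<le> 1"
  by (auto intro!: prod_nonneg prod_le_1 split: split_indicator)

lemma expectation_\<xi>:
  assumes "\<beta> \<in> injections k n"
  shows "expectation (\<xi> \<beta>) = p ^ card E * h"
proof -
  have "expectation (\<xi> \<beta>) = p ^ card ((`) \<beta> ` E) * expectation (W \<beta>)"
    unfolding \<xi>_eq[OF assms] W_eq[OF assms] by (rule expectation_edges[OF copy_edges(1)[OF assms]])
  then show ?thesis
    using card_image[OF copy_edges(2)[OF assms]] by (simp only: expectation_W[OF injectionsD[OF assms]])
qed

text \<open>Shared edges can only help: merging them leaves fewer factors \<open>p \<le> 1\<close>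
  and fewer factors of \<open>H\<close>, each at most 1. On the diagonal all edges are shared, which
  yields the extra term.\<close>

lemma expectation_\<xi>_mult_ge:
  assumes \<beta>: "\<beta> \<in> injections k n" and \<gamma>: "\<gamma> \<in> injections k n"
  shows "expectation (\<lambda>\<omega>. \<xi> \<beta> \<omega> * \<xi> \<gamma> \<omega>) \<ge> p ^ (2 * card E) * expectation (\<lambda>\<omega>. W \<beta> \<omega> * W \<gamma> \<omega>)
     + (if \<beta> = \<gamma> then (p ^ card E - p ^ (2 * card E)) * h else 0)"
proof (cases "\<beta> = \<gamma>")
  case True
  \<comment> \<open>Indicators are idempotent, so the diagonal moment carries
    \<open>p ^ card E\<close> instead of \<open>p ^ (2 * card E)\<close>; the weights only satisfy
    the inequality \<open>W * W \<le> W\<close> used below.\<close>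
  have "\<xi> \<beta> \<omega> * \<xi> \<beta> \<omega> = \<xi> \<beta> \<omega>" for \<omega>
    unfolding prod.distrib[symmetric] by (intro prod.cong) (auto split: split_indicator)
  then have "expectation (\<lambda>\<omega>. \<xi> \<beta> \<omega> * \<xi> \<gamma> \<omega>) = p ^ card E * h"
    using True expectation_\<xi>[OF \<beta>] by (simp only:)
  moreover have "expectation (\<lambda>\<omega>. W \<beta> \<omega> * W \<gamma> \<omega>) \<le> expectation (W \<beta>)"
    using w_range True \<beta> by (intro integral_mono integrable_W_mult_W integrable_W injectionsD mult_left_le) auto
  then have "p ^ (2 * card E) * expectation (\<lambda>\<omega>. W \<beta> \<omega> * W \<gamma> \<omega>) \<le> p ^ (2 * card E) * h"
    unfolding expectation_W[OF injectionsD[OF \<beta>]] using p_range by (intro mult_left_mono) auto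
  ultimately show ?thesis
    using True by (simp add: algebra_simps)
next
  case False
  let ?B = "(`) \<beta> ` E" and ?C = "(`) \<gamma> ` E"
  let ?S = "?B \<union> ?C"
  have S: "?S \<subseteq> vertex_pairs n"
    using copy_edges(1) \<beta> \<gamma> by auto
  have fin: "finite ?B" "finite ?C" by auto
  have prod_eq: "\<xi> \<beta> \<omega> * \<xi> \<gamma> \<omega> = (\<Prod>e\<in>?S. indicator (A e) \<omega>)" for \<omega>
  proof -
    \<comment> \<open>As a truth value the product is insensitive to repeated edges, so the two
      products merge into one over the union.\<close>
    have "(\<Prod>e\<in>F. indicator (A e) \<omega> :: real) = of_bool (\<forall>e\<in>F. \<omega> \<in> A e)" if "finite F" for F
      using that by (induction F rule: finite_induct) auto
    with fin show ?thesis
      unfolding \<xi>_eq[OF \<beta>] \<xi>_eq[OF \<gamma>] by auto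
  qed
  have "W \<beta> \<omega> * W \<gamma> \<omega> \<le> (\<Prod>e\<in>?S. on_pair H (\<lambda>i. X i \<omega>) e)" for \<omega>
  proof -
    have "W \<beta> \<omega> * W \<gamma> \<omega> = (\<Prod>e\<in>?S. on_pair H (\<lambda>i. X i \<omega>) e) * (\<Prod>e\<in>?B \<inter> ?C. on_pair H (\<lambda>i. X i \<omega>) e)"
      unfolding W_eq[OF \<beta>] W_eq[OF \<gamma>] using fin by (rule prod.union_inter[symmetric])
    also have "\<dots> \<le> (\<Prod>e\<in>?S. on_pair H (\<lambda>i. X i \<omega>) e)"
      by (intro mult_left_le prod_on_pair_range)
    finally show ?thesis .
  qed
  then have "expectation (\<lambda>\<omega>. W \<beta> \<omega> * W \<gamma> \<omega>) \<le> expectation (\<lambda>\<omega>. \<Prod>e\<in>?S. on_pair H (\<lambda>i. X i \<omega>) e)"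
    using \<beta> \<gamma> S by (intro integral_mono integrable_W_mult_W integrable_W_prod injectionsD)
  moreover have "card ?S \<le> 2 * card E"
    using card_Un_le[of ?B ?C] card_image_le[of E "(`) \<beta>"] card_image_le[of E "(`) \<gamma>"] by simp
  then have "p ^ (2 * card E) \<le> p ^ card ?S"
    using p_range by (intro power_decreasing) auto
  moreover have "0 \<le> expectation (\<lambda>\<omega>. W \<beta> \<omega> * W \<gamma> \<omega>)"
    using w_range by simp
  ultimately have "p ^ (2 * card E) * expectation (\<lambda>\<omega>. W \<beta> \<omega> * W \<gamma> \<omega>)
      \<le> p ^ card ?S * expectation (\<lambda>\<omega>. \<Prod>e\<in>?S. on_pair H (\<lambda>i. X i \<omega>) e)"
    using p_range by (intro mult_mono) auto
  then show ?thesis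
    using False unfolding prod_eq expectation_edges[OF S] by simp
qed

text \<open>Second moments are compared pair by pair, while the means agree exactly up to the factor
  \<open>p ^ card E\<close>.\<close>

lemma variance_copies_ge:
  "variance (\<lambda>\<omega>. \<Sum>\<beta>\<in>injections k n. \<xi> \<beta> \<omega>)
    \<ge> p ^ (2 * card E) * variance U + num_copies * (p ^ card E - p ^ (2 * card E)) * h"
proof -
  let ?I = "injections k n" and ?d = "(p ^ card E - p ^ (2 * card E)) * h"
  let ?S = "\<lambda>\<omega>. \<Sum>\<beta>\<in>?I. \<xi> \<beta> \<omega>"
  have int\<xi>\<xi>: "integrable M (\<lambda>\<omega>. \<xi> \<beta> \<omega> * \<xi> \<gamma> \<omega>)" if "\<beta> \<in> ?I" "\<gamma> \<in> ?I" for \<beta> \<gamma>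
    using \<xi>_range that
    by (intro integrable_bounded[where B = 1] borel_measurable_times \<xi>_meas) (auto simp: abs_mult intro!: mult_le_one)
  have int\<xi>: "integrable M (\<xi> \<beta>)" if "\<beta> \<in> ?I" for \<beta>
    using \<xi>_range that by (intro integrable_bounded[where B = 1] \<xi>_meas) auto
  have intS: "integrable M ?S"
    by (intro Bochner_Integration.integrable_sum int\<xi>)
  have intS2: "integrable M (\<lambda>\<omega>. (?S \<omega>)\<^sup>2)"
    unfolding power2_eq_square sum_product by (intro Bochner_Integration.integrable_sum int\<xi>\<xi>)
  have intU: "integrable M U"
    by (intro Bochner_Integration.integrable_sum integrable_W injectionsD)
  \<comment> \<open>Stated for a general family \<open>Z\<close>, since it is applied both to the
    weights and to the indicators.\<close>
  have second_moment: "expectation (\<lambda>\<omega>. (\<Sum>\<beta>\<in>?I. Z \<beta> \<omega>)\<^sup>2)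
      = (\<Sum>\<beta>\<in>?I. \<Sum>\<gamma>\<in>?I. expectation (\<lambda>\<omega>. Z \<beta> \<omega> * Z \<gamma> \<omega>))"
    if "\<And>\<beta> \<gamma>. \<beta> \<in> ?I \<Longrightarrow> \<gamma> \<in> ?I \<Longrightarrow> integrable M (\<lambda>\<omega>. Z \<beta> \<omega> * Z \<gamma> \<omega>)"
    for Z :: "_ \<Rightarrow> _ \<Rightarrow> real"
    unfolding power2_eq_square sum_product
    by (subst Bochner_Integration.integral_sum)
       (intro sum.cong refl Bochner_Integration.integral_sum
         Bochner_Integration.integrable_sum that; assumption)+
  have "p ^ (2 * card E) * expectation (\<lambda>\<omega>. (U \<omega>)\<^sup>2) + num_copies * ?d
      = (\<Sum>\<beta>\<in>?I. \<Sum>\<gamma>\<in>?I. p ^ (2 * card E) * expectation (\<lambda>\<omega>. W \<beta> \<omega> * W \<gamma> \<omega>) + (if \<beta> = \<gamma> then ?d else 0))"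
    by (subst second_moment) (auto intro!: integrable_W_mult_W dest: injectionsD simp: sum.distrib sum_distrib_left)
  also have "\<dots> \<le> (\<Sum>\<beta>\<in>?I. \<Sum>\<gamma>\<in>?I. expectation (\<lambda>\<omega>. \<xi> \<beta> \<omega> * \<xi> \<gamma> \<omega>))"
    by (intro sum_mono expectation_\<xi>_mult_ge)
  also have "\<dots> = expectation (\<lambda>\<omega>. (?S \<omega>)\<^sup>2)"
    by (rule second_moment[symmetric]) (rule int\<xi>\<xi>)
  finally have "p ^ (2 * card E) * expectation (\<lambda>\<omega>. (U \<omega>)\<^sup>2) + num_copies * ?d \<le> expectation (\<lambda>\<omega>. (?S \<omega>)\<^sup>2)" .
  moreover have "expectation ?S = p ^ card E * expectation U"
  proof -
    have "expectation ?S = (\<Sum>\<beta>\<in>?I. expectation (\<xi> \<beta>))"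
      by (intro Bochner_Integration.integral_sum int\<xi>)
    also have "\<dots> = (\<Sum>\<beta>\<in>?I. p ^ card E * h)"
      by (intro sum.cong refl expectation_\<xi>)
    finally show ?thesis by (simp add: expectation_U)
  qed
  \<comment> \<open>The squared mean scales by the same \<open>p ^ (2 * card E)\<close> as the
    second moment, so subtracting it leaves exactly the scaled variance of \<open>U\<close>.\<close>
  then have "(expectation ?S)\<^sup>2 = p ^ (2 * card E) * (expectation U)\<^sup>2"
    by (simp only: power_mult_distrib power_even_eq)
  ultimately show ?thesis
    unfolding variance_eq[OF intS intS2] variance_eq[OF intU integrable_U_sq]
    by (simp only: right_diff_distrib[of "p ^ (2 * card E)"] mult.assoc)
qed

lemma variance_subgraph_count:
  "variance (subgraph_count k E n A)
    = variance (\<lambda>\<omega>. \<Sum>\<beta>\<in>injections k n. \<xi> \<beta> \<omega>) / (real (num_aut k E))\<^sup>2"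
  by (simp add: subgraph_count_def[abs_def] power_divide flip: diff_divide_distrib)

end

section \<open>The lower bound with a constant uniform in n\<close>

theorem proposition6p1:
  fixes k :: nat
    and E :: "nat set set"
    and \<mu> :: "'a::euclidean_space measure"
    and H :: "'a \<Rightarrow> 'a \<Rightarrow> real"
    and p :: "nat \<Rightarrow> real"
    and M :: "nat \<Rightarrow> 'w measure"
    and X :: "nat \<Rightarrow> nat \<Rightarrow> 'w \<Rightarrow> 'a"
    and A :: "nat \<Rightarrow> nat set \<Rightarrow> 'w set"
  assumes "k \<ge> 2" and "connected_graph k E"
    and "prob_space \<mu>" and "sets \<mu> = sets borel" and "\<And>x. measure \<mu> {x} = 0"
    and "(\<lambda>(x, y). H x y) \<in> borel_measurable (borel \<Otimes>\<^sub>M borel)"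
    and "\<And>x y. H x y = H y x" and "\<And>x y. H x y \<in> {0..1}"
    and "\<And>n. p n \<in> {0<..<1}"
    and "\<And>n. binomial_rcm (M n) n \<mu> H (p n) (X n) (A n)"
    and "\<exists>n\<ge>1. prob_space.variance (M n)
           (\<lambda>\<omega>. \<Sum>l=1..k. f_proj k E \<mu> H (p n) l (X n 1 \<omega>)) > 0"
  shows "\<exists>C>0. \<forall>n\<ge>2 * k - 1.
    prob_space.variance (M n) (subgraph_count k E n (A n))
      \<ge> C / real (num_aut k E) ^ 2 *
         (fact n / fact (n + 1 - 2 * k) * p n ^ (2 * card E)
          + fact n / fact (n - k) * p n ^ card E)"
proof -
  let ?G = "rooted_density_sum k E \<mu> H" and ?h = "copy_density k E \<mu> H"
  let ?s = "projection_variance k E \<mu> H"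
  define C where "C = min (?s / 2) ?h"
  have rcm: "rcm_pattern (M n) n \<mu> H (p n) (X n) (A n) k E" if "n \<ge> 1" for n
    using that assms(2-4,6-8) assms(9)[of n]
    by (intro rcm_pattern.intro rcm_pattern_axioms.intro assms(10))
       (auto simp: connected_graph_def simple_graph_def)
  \<comment> \<open>The mean of \<open>?G\<close> and the positivity of \<open>?h\<close> concern
    only \<mu>, \<open>H\<close> and the pattern, but their proofs use a model with at least
    \<open>k\<close> points; the one with exactly \<open>k\<close> points serves.\<close>
  interpret K: rcm_pattern "M k" k \<mu> H "p k" "X k" "A k" k E
    by (rule rcm) (use \<open>k \<ge> 2\<close> in simp)
  from assms(11) obtain n0 where n0: "n0 \<ge> 1"
    and pos: "prob_space.variance (M n0) (\<lambda>\<omega>. \<Sum>l=1..k. f_proj k E \<mu> H (p n0) l (X n0 1 \<omega>)) > 0"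
    by auto
  have "?s > 0"
  proof -
    interpret N: rcm_pattern "M n0" n0 \<mu> H "p n0" "X n0" "A n0" k E
      by (rule rcm[OF n0])
    let ?c = "p n0 ^ card E / real (num_aut k E)"
    have f: "(\<Sum>l=1..k. f_proj k E \<mu> H (p n0) l x) = ?c * ?G x" for x
      by (simp only: f_proj_eq rooted_density_sum_def sum_distrib_left)
    \<comment> \<open>Since \<open>n0\<close> may be smaller than \<open>k\<close>, the integral of
      \<open>?G\<close> is taken from the instance \<open>K\<close>.\<close>
    have mean: "N.expectation (\<lambda>\<omega>. ?G (X n0 1 \<omega>)) = k * ?h"
      using N.integral_X_single[of 1 ?G] n0 K.integral_\<phi> by (simp add: K.points.prob_space)
    have "N.variance (\<lambda>\<omega>. \<Sum>l=1..k. f_proj k E \<mu> H (p n0) l (X n0 1 \<omega>))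
        = ?c\<^sup>2 * N.expectation (\<lambda>\<omega>. (?G (X n0 1 \<omega>) - k * ?h)\<^sup>2)"
      unfolding f integral_mult_right_zero mean right_diff_distrib[symmetric] power_mult_distrib ..
    also have "N.expectation (\<lambda>\<omega>. (?G (X n0 1 \<omega>) - k * ?h)\<^sup>2) = ?s"
      unfolding projection_variance_def
      using n0 by (intro N.integral_X_single[of 1 "\<lambda>x. (?G x - k * ?h)\<^sup>2"]) auto
    finally have "?c\<^sup>2 * ?s > 0"
      using pos by simp
    then show ?thesis
      by (simp add: zero_less_mult_iff)
  qed
  then have "?h > 0"
    by (intro K.density_pos) auto
  have "C > 0"
    using \<open>?s > 0\<close> \<open>?h > 0\<close> by (simp add: C_def)
  moreover have "prob_space.variance (M n) (subgraph_count k E n (A n))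
      \<ge> C / real (num_aut k E) ^ 2 *
         (fact n / fact (n + 1 - 2 * k) * p n ^ (2 * card E) + fact n / fact (n - k) * p n ^ card E)"
    if n: "n \<ge> 2 * k - 1" for n
  proof -
    from n \<open>k \<ge> 2\<close> have "n \<ge> 1" "k \<le> n" by auto
    interpret N: rcm_pattern "M n" n \<mu> H "p n" "X n" "A n" k E
      by (rule rcm) fact
    \<comment> \<open>The form \<open>n + 1 - 2 * k\<close> keeps natural subtraction exact down to
      \<open>n = 2 * k - 1\<close>, where the denominator is \<open>fact 0\<close>.\<close>
    define a :: real where "a = fact n / fact (n + 1 - 2 * k)"
    define b :: real where "b = fact n / fact (n - k)"
    define q where "q = p n ^ card E"
    have q2: "p n ^ (2 * card E) = q\<^sup>2"
      by (simp add: q_def power_mult[symmetric] mult.commute)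
    have q: "0 \<le> q" "q\<^sup>2 \<le> q"
      using assms(9)[of n] by (auto simp: q_def power2_eq_square intro!: mult_left_le power_le_one)
    have "b \<ge> 0" by (simp add: b_def)
    have "b \<le> a"
      using \<open>k \<ge> 2\<close> by (auto simp: a_def b_def intro!: divide_left_mono fact_mono)
    have "a * ?s \<le> b\<^sup>2 / n * ?s"
      unfolding a_def b_def using n \<open>k \<ge> 2\<close> \<open>?s > 0\<close> by (intro mult_right_mono fact_quotient_le_square) auto
    also have "\<dots> \<le> N.variance N.U"
      using N.variance_U_ge[OF \<open>k \<le> n\<close>] card_injections[OF \<open>k \<le> n\<close>] by (simp add: b_def)
    finally have "q\<^sup>2 * (a * ?s) \<le> q\<^sup>2 * N.variance N.U"
      by (intro mult_left_mono) auto
    moreover have "C * (a * q\<^sup>2 + b * q) \<le> q\<^sup>2 * (a * ?s) + b * (q - q\<^sup>2) * ?h"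
    proof -
      \<comment> \<open>Splitting \<open>b * q\<close> as \<open>b * q^2 + b * (q - q^2)\<close>
        separates the two regimes. The first part uses \<open>C \<le> ?s / 2\<close> with
        \<open>a + b \<le> 2 * a\<close>, the second uses \<open>C \<le> ?h\<close> with
        \<open>q^2 \<le> q\<close>.\<close>
      have "C * (a * q\<^sup>2 + b * q) = C * ((a + b) * q\<^sup>2) + C * (b * (q - q\<^sup>2))"
        by (simp add: algebra_simps)
      also have "\<dots> \<le> ?s / 2 * (2 * a * q\<^sup>2) + ?h * (b * (q - q\<^sup>2))"
        using q \<open>b \<ge> 0\<close> \<open>b \<le> a\<close> \<open>?s > 0\<close>
        by (intro add_mono mult_mono mult_right_mono) (auto simp: C_def)
      finally show ?thesis by (simp add: algebra_simps)
    qed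
    ultimately have "C * (a * q\<^sup>2 + b * q) \<le> N.variance (\<lambda>\<omega>. \<Sum>\<beta>\<in>injections k n. N.\<xi> \<beta> \<omega>)"
      using N.variance_copies_ge card_injections[OF \<open>k \<le> n\<close>] by (simp add: q2 b_def flip: q_def)
    then show ?thesis
      unfolding N.variance_subgraph_count q2 a_def[symmetric] b_def[symmetric] q_def[symmetric]
      by (simp add: divide_right_mono)
  qed
  ultimately show ?thesis by blast
qed

end
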